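(* (Relative Mennicke–Newman) Let $R$ be a ring of stable dimension $d$, let $n$ be an integer with $d\le 2n-3$, and let $I$ be an ideal in $R$. Let $v,w\in\mathrm{Um}_n(R,I)$. Then there exist $\varepsilon_1,\varepsilon_2\in\mathrm{E}_n(R,I)$ such that $v\varepsilon_1=(a_1,a_2,\dots,a_{n-1},a)$ and $w\varepsilon_2=(a_1,a_2,\dots,a_{n-1},b)$ with $a+b$ a unit modulo the ideal $(a_1,a_2,\dots,a_{n-1})$.
   Context: All rings are commutative with unity. $\mathrm{Um}_n(R)$ is the set of rows $v\in R^n$ such that $v\cdot w^t=1$ for some $w\in R^n$. For an ideal $I$ of $R$, $\mathrm{Um}_n(R,I)$ is the set of $v\in \mathrm{Um}_n(R)$ with $v\equiv (1,0,\dots,0)$ modulo $I$. $\mathrm{E}_n(R)$ is the subgroup of $\mathrm{GL}_n(R)$ generated by the matrices $E_{ij}(\lambda)=I_n+\lambda e_{ij}$, $i\neq j$, $\lambda\in R$; $\mathrm{E}_n(R,I)$ is the smallest normal subgroup of $\mathrm{E}_n(R)$ containing all $E_{21}(x)$, $x\in I$. Stable range condition $Sr_n(I)$ holds for an ideal $I$ if for every $(a_1,\dots,a_{n+1})\in\mathrm{Um}_{n+1}(R,I)$ there exist $c_1,\dots,c_n\in I$ with $(a_1+c_1a_{n+1},\dots,a_n+c_na_{n+1})\in\mathrm{Um}_n(R,I)$. The stable range $Sr(I)$ is the least $n$ such that $Sr_n(I)$ holds, and the stable dimension is $Sd(I)=Sr(I)-1$. The stable dimension of the ring $R$ is $Sd(R)$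 (the case $I=R$). *)

theory Defs
  imports
    "HOL-Library.Extended_Nat"
    "HOL-Algebra.QuotRing"
    "HOL-Algebra.Generated_Groups"
    "Jordan_Normal_Form.Gauss_Jordan_Elimination"
    "Jordan_Normal_Form.VS_Connect"
begin

text \<open>
  The ring \<open>R\<close> is the type \<open>'a :: comm_ring_1\<close>; \<open>class_ring\<close> is the same ring as an HOL-Algebra
  record with carrier \<open>UNIV\<close>, and an ideal of \<open>R\<close> is a set \<open>I\<close> with \<open>ideal I class_ring\<close>
  (\<open>I = UNIV\<close> is allowed).  Vectors and matrices are indexed from \<open>0\<close>.
\<close>

definition Um :: "nat \<Rightarrow> 'a :: comm_ring_1 vec set" where
  "Um n = {v \<in> carrier_vec n. \<exists>w \<in> carrier_vec n. v \<bullet> w = 1}"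

definition Um_rel :: "nat \<Rightarrow> 'a :: comm_ring_1 set \<Rightarrow> 'a vec set" where
  "Um_rel n I = {v \<in> Um n. \<forall>i<n. v $ i - unit_vec n 0 $ i \<in> I}"

definition GL :: "nat \<Rightarrow> 'a :: comm_ring_1 mat monoid" where
  "GL n = units_of (ring_mat TYPE('a) n ())"

text \<open>For \<open>i \<noteq> j\<close>, \<open>addrow_mat n x i j\<close> is the identity matrix plus \<open>x\<close> in position \<open>(i, j)\<close>.\<close>

definition E :: "nat \<Rightarrow> 'a :: comm_ring_1 mat set" where
  "E n = generate (GL n) {addrow_mat n x i j | x i j. i < n \<and> j < n \<and> i \<noteq> j}"

definition E_rel :: "nat \<Rightarrow> 'a :: comm_ring_1 set \<Rightarrow> 'a mat set" where
  "E_rel n I = \<Inter>{N. N \<lhd> (GL n)\<lparr>carrier := E n\<rparr> \<and> (\<forall>x\<in>I. addrow_mat n x 1 0 \<in> N)}"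

text \<open>The product of a row with a matrix; the library's \<open>*\<^sub>v\<close> acts on columns.\<close>

definition row_mult :: "'a :: comm_ring_1 vec \<Rightarrow> 'a mat \<Rightarrow> 'a vec" where
  "row_mult v A = vec (dim_col A) (\<lambda>j. v \<bullet> col A j)"

definition stable_range_cond :: "nat \<Rightarrow> 'a :: comm_ring_1 set \<Rightarrow> bool" where
  "stable_range_cond n I \<longleftrightarrow>
     (\<forall>a \<in> Um_rel (n + 1) I. \<exists>c \<in> carrier_vec n.
        (\<forall>i<n. c $ i \<in> I) \<and> vec n (\<lambda>i. a $ i + c $ i * a $ n) \<in> Um_rel n I)"

text \<open>
  The stable range is \<open>\<infinity>\<close> if no stable range condition holds.  Only \<open>n \<ge> 1\<close> is considered, so
  the subtraction below does not truncate; since \<open>1 \<noteq> 0\<close> in \<open>R\<close>, the condition for \<open>n = 0\<close> is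
  false anyway.
\<close>

definition stable_range :: "'a :: comm_ring_1 set \<Rightarrow> enat" where
  "stable_range I = (INF n \<in> {n. 1 \<le> n \<and> stable_range_cond n I}. enat n)"

definition stable_dim :: "'a :: comm_ring_1 set \<Rightarrow> enat" where
  "stable_dim I = stable_range I - 1"

definition unit_mod :: "'a :: comm_ring_1 \<Rightarrow> 'a set \<Rightarrow> bool" where
  "unit_mod x J \<longleftrightarrow> J +>\<^bsub>class_ring\<^esub> x \<in> Units (class_ring Quot J)"

end

theory Submission
  imports Defs
begin

text \<open>
  Put \<open>m = n - 1\<close>. The hypothesis says that the stable range of \<open>R\<close> is at most \<open>2m\<close>, and it is
  applied to a row of length \<open>2m + 1\<close> built from \<open>v\<close> and \<open>w\<close> together:
  \<open>(v\<^sub>0, \<dots>, v\<^bsub>m-1\<^esub>, w\<^sub>0, \<dots>, w\<^bsub>m-1\<^esub>, v\<^sub>m w\<^sub>m)\<close>. It is unimodular, because a maximal ideal containing all its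
  entries would contain all of \<open>v\<close> or all of \<open>w\<close>. So after adding multiples of \<open>v\<^sub>m w\<^sub>m\<close> to the
  first \<open>m\<close> entries of \<open>v\<close> and of \<open>w\<close>, these \<open>2m\<close> entries generate the unit ideal. A multiple
  \<open>c v\<^sub>m w\<^sub>m\<close> is \<open>(c w\<^sub>m) v\<^sub>m\<close>, and \<open>w\<^sub>m \<in> I\<close>; the same holds with \<open>v\<close> and \<open>w\<close> exchanged. Hence the
  absolute condition yields operations from \<open>E\<^sub>n(R, I)\<close> (\<open>unimodular_after_adding_product\<close>).

  Now \<open>t = 1 - v\<^sub>m - v\<^sub>0 - w\<^sub>m\<close> lies in \<open>I\<close>, and it is a combination of those \<open>2m\<close> entries with
  coefficients in \<open>I\<close>. Adding the two parts of this combination to \<open>v\<^sub>m\<close> and to \<open>w\<^sub>m\<close> yields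
  \<open>\<alpha> + \<beta> = 1\<close> for \<open>\<alpha> = v\<^sub>m + v\<^sub>0\<close> and \<open>\<beta> = w\<^sub>m\<close>.

  In the absolute case one would have rows ending in \<open>\<alpha>\<close> and \<open>\<beta>\<close> with \<open>\<alpha> + \<beta> = 1\<close>, and replace
  \<open>v\<^sub>j\<close> by \<open>v\<^sub>j + (w\<^sub>j - v\<^sub>j) \<alpha>\<close> and \<open>w\<^sub>j\<close> by \<open>w\<^sub>j + (v\<^sub>j - w\<^sub>j) \<beta>\<close>: both are \<open>v\<^sub>j \<beta> + w\<^sub>j \<alpha>\<close>. This is
  what happens here after the column operation that adds \<open>v\<^sub>0\<close> to \<open>v\<^sub>m\<close>. That operation need not be
  in \<open>E\<^sub>n(R, I)\<close>, but \<open>E\<^sub>n(R, I)\<close> is normal in \<open>E\<^sub>n(R)\<close>, so it can be performed first and undone at the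
  end (\<open>E_rel_equiv_common_row\<close>). Undoing it turns the last entry \<open>\<alpha>\<close> into \<open>\<alpha> - c\<^sub>0\<close>, where
  \<open>c\<^sub>0\<close> is the common first entry, and then \<open>a + b = \<alpha> - c\<^sub>0 + \<beta> = 1 - c\<^sub>0\<close> is \<open>1\<close> modulo
  \<open>(c\<^sub>0, \<dots>, c\<^bsub>m-1\<^esub>)\<close>.
\<close>

section \<open>The relative elementary group\<close>

lemma group_GL: "group (GL n :: 'a :: comm_ring_1 mat monoid)"
proof -
  interpret ring "ring_mat TYPE('a) n ()" by (rule ring_mat)
  show ?thesis unfolding GL_def by (rule units_group)
qed

lemma GL_simps:
  "mult (GL n) = (*)" "one (GL n :: 'a :: comm_ring_1 mat monoid) = 1\<^sub>m n"
  by (simp_all add: GL_def units_of_def ring_mat_simps)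

lemma GL_subset_carrier_mat: "carrier (GL n :: 'a :: comm_ring_1 mat monoid) \<subseteq> carrier_mat n n"
  by (auto simp: GL_def units_of_def Units_def ring_mat_simps)

lemma addrow_mat_in_GL:
  "i < n \<Longrightarrow> j < n \<Longrightarrow> i \<noteq> j \<Longrightarrow> addrow_mat n (x :: 'a :: comm_ring_1) i j \<in> carrier (GL n)"
  by (simp add: GL_def units_of_def addrow_mat_Unit)

lemma subgroup_E: "subgroup (E n :: 'a :: comm_ring_1 mat set) (GL n)"
  unfolding E_def by (rule group.generate_is_subgroup[OF group_GL]) (auto intro: addrow_mat_in_GL)

lemma addrow_mat_in_E:
  "i < n \<Longrightarrow> j < n \<Longrightarrow> i \<noteq> j \<Longrightarrow> addrow_mat n (x :: 'a :: comm_ring_1) i j \<in> E n"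
  unfolding E_def by (rule generate.incl) auto

lemma inv_addrow_mat:
  fixes x :: "'a :: comm_ring_1"
  assumes "i < n" "j < n" "i \<noteq> j"
  shows "inv\<^bsub>(GL n)\<lparr>carrier := E n\<rparr>\<^esub> (addrow_mat n x i j) = addrow_mat n (- x) i j"
proof -
  interpret G: group "(GL n)\<lparr>carrier := E n :: 'a mat set\<rparr>"
    by (rule group.subgroup_imp_group[OF group_GL subgroup_E])
  show ?thesis
    by (rule G.inv_equality)
      (use assms addrow_mat_inv[OF assms, of "- x"] in \<open>simp_all add: GL_simps addrow_mat_in_E\<close>)
qed

lemma E_rel_one: "1\<^sub>m n \<in> (E_rel n I :: 'a :: comm_ring_1 mat set)"
  unfolding E_rel_def
  by (auto dest!: normal_imp_subgroup subgroup.one_closed simp: GL_simps)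

lemma E_rel_mult: "A \<in> E_rel n I \<Longrightarrow> B \<in> E_rel n I \<Longrightarrow> A * B \<in> E_rel n I"
  unfolding E_rel_def
proof (clarify)
  fix N assume AB: "A \<in> \<Inter>{N. N \<lhd> (GL n)\<lparr>carrier := E n\<rparr> \<and> (\<forall>x\<in>I. addrow_mat n x 1 0 \<in> N)}"
      "B \<in> \<Inter>{N. N \<lhd> (GL n)\<lparr>carrier := E n\<rparr> \<and> (\<forall>x\<in>I. addrow_mat n x 1 0 \<in> N)}"
    and N: "N \<lhd> (GL n)\<lparr>carrier := E n\<rparr>" "\<forall>x\<in>I. addrow_mat n x 1 0 \<in> N"
  then have "A \<in> N" "B \<in> N" by blast+
  then show "A * B \<in> N"
    using subgroup.m_closed[OF normal_imp_subgroup[OF N(1)]] by (simp add: GL_simps)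
qed

lemma E_rel_conj:
  assumes "A \<in> E_rel n I" "i < n" "j < n" "i \<noteq> j"
  shows "addrow_mat n y i j * A * addrow_mat n (- y) i j \<in> E_rel n I"
  unfolding E_rel_def
proof (clarify)
  fix N assume N: "N \<lhd> (GL n)\<lparr>carrier := E n\<rparr>" "\<forall>x\<in>I. addrow_mat n x 1 0 \<in> N"
  with assms have "A \<in> N" unfolding E_rel_def by blast
  then show "addrow_mat n y i j * A * addrow_mat n (- y) i j \<in> N"
    using normal.inv_op_closed2[OF N(1), of "addrow_mat n y i j" A] assms(2-)
    by (simp add: inv_addrow_mat addrow_mat_in_E GL_simps)
qed

lemma E_rel_subset_E:
  assumes "2 \<le> n"
  shows "E_rel n (I :: 'a :: comm_ring_1 set) \<subseteq> E n"
proof -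
  interpret G: group "(GL n)\<lparr>carrier := E n :: 'a mat set\<rparr>"
    by (rule group.subgroup_imp_group[OF group_GL subgroup_E])
  show ?thesis
    unfolding E_rel_def using G.normal_self assms by (auto simp: addrow_mat_in_E)
qed

lemma E_rel_carrier:
  "2 \<le> n \<Longrightarrow> A \<in> E_rel n (I :: 'a :: comm_ring_1 set) \<Longrightarrow> A \<in> carrier_mat n n"
  using E_rel_subset_E subgroup.subset[OF subgroup_E] GL_subset_carrier_mat by blast

section \<open>Elementary matrices acting on rows\<close>

lemma row_mult_eq:
  "v \<in> carrier_vec n \<Longrightarrow> A \<in> carrier_mat n m \<Longrightarrow> row_mult v A = A\<^sup>T *\<^sub>v v"
  by (rule eq_vecI) (auto simp: row_mult_def intro!: comm_scalar_prod[of _ n] col_carrier_vec)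

lemma row_mult_mult:
  assumes "v \<in> carrier_vec n" "A \<in> carrier_mat n n" "B \<in> carrier_mat n n"
  shows "row_mult v (A * B) = row_mult (row_mult v A) B"
proof -
  have "row_mult v A \<in> carrier_vec n" using assms by (simp add: row_mult_def)
  then show ?thesis
    using assms by (simp add: row_mult_eq[of _ n _ n] transpose_mult[of _ n n _ n]
      assoc_mult_mat_vec[of _ n n _ n])
qed

lemma row_mult_one: "v \<in> carrier_vec n \<Longrightarrow> row_mult v (1\<^sub>m n) = v"
  by (simp add: row_mult_eq[of _ n _ n])

lemma row_mult_addrow_mat:
  assumes "v \<in> carrier_vec n" "i < n" "j < n" "i \<noteq> j"
  shows "row_mult v (addrow_mat n x i j) = vec n (\<lambda>k. if k = j then v $ j + x * v $ i else v $ k)"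
proof (rule eq_vecI)
  fix k assume "k < dim_vec (vec n (\<lambda>k. if k = j then v $ j + x * v $ i else v $ k))"
  then have k: "k < n" by simp
  have "v \<bullet> col (addrow_mat n x i j) k = (\<Sum>l<n. v $ l * (addrow_mat n x i j) $$ (l,k))"
    using k by (simp add: scalar_prod_def lessThan_atLeast0)
  also have "\<dots> = (\<Sum>l<n. (if l = k then v $ k else 0) + (if l = i \<and> k = j then x * v $ i else 0))"
    using k assms by (intro sum.cong) (auto simp: algebra_simps)
  also have "\<dots> = (if k = j then v $ j + x * v $ i else v $ k)"
    using k assms by (cases "k = j") (simp_all add: sum.distrib)
  finally show "row_mult v (addrow_mat n x i j) $ k = vec n (\<lambda>k. if k = j then v $ j + x * v $ i else v $ k) $ k"
    using k by (simp add: row_mult_def)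
qed (simp add: row_mult_def)

text \<open>
  Identities between products of elementary matrices are checked through their action on rows,
  where each factor just changes one entry.
\<close>

lemma mat_eq_by_rows:
  assumes "A \<in> carrier_mat n n" "B \<in> carrier_mat n n"
    and "\<And>v :: 'a :: comm_ring_1 vec. v \<in> carrier_vec n \<Longrightarrow> row_mult v A = row_mult v B"
  shows "A = B"
proof (rule eq_matI)
  fix i j assume ij: "i < dim_row B" "j < dim_col B"
  have "row_mult (unit_vec n i) A $ j = row_mult (unit_vec n i) B $ j" using assms(3) by simp
  then show "A $$ (i,j) = B $$ (i,j)" using ij assms(1,2) by (simp add: row_mult_def)
qed (use assms in auto)

text \<open>
  The matrix \<open>E\<^bsub>ij\<^esub>(1) E\<^bsub>ji\<^esub>(-1) E\<^bsub>ij\<^esub>(1)\<close> swaps the coordinates \<open>i\<close> and \<open>j\<close> up to a sign, so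
  conjugation by it exchanges the two off-diagonal positions. Commutators would need a third index,
  which does not exist for \<open>n = 2\<close>.
\<close>

lemma E_rel_swap:
  fixes x :: "'a :: comm_ring_1"
  assumes n: "i < n" "j < n" "i \<noteq> j" and el: "addrow_mat n (- x) i j \<in> E_rel n I"
  shows "addrow_mat n x j i \<in> E_rel n I"
proof -
  let ?e = "\<lambda>y. addrow_mat n y i j" and ?f = "\<lambda>y. addrow_mat n y j i"
  have "?e 1 * (?f (-1) * (?e 1 * ?e (- x) * ?e (- 1)) * ?f (- (- 1))) * ?e (- 1) \<in> E_rel n I"
    using n el by (intro E_rel_conj) auto
  also have "?e 1 * (?f (-1) * (?e 1 * ?e (- x) * ?e (- 1)) * ?f (- (- 1))) * ?e (- 1) = ?f x"
    by (rule mat_eq_by_rows[of _ n])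
      (use n in \<open>auto simp: row_mult_mult[of _ n] row_mult_addrow_mat[of _ n] mult_carrier_mat[of _ n n]
         intro!: eq_vecI, (auto simp: algebra_simps)?\<close>)
  finally show ?thesis .
qed

text \<open>
  For three different indices the commutator of \<open>E\<^bsub>ij\<^esub>(x)\<close> with \<open>E\<^bsub>jk\<^esub>(1)\<close> is \<open>E\<^bsub>ik\<^esub>(\<plusminus>x)\<close>, so one
  position in \<open>E_rel\<close> propagates along its row and, dually, along its column.
\<close>

lemma E_rel_move_column:
  fixes x :: "'a :: comm_ring_1"
  assumes n: "i < n" "j < n" "k < n" "i \<noteq> j" "j \<noteq> k" "i \<noteq> k"
    and el: "addrow_mat n x i j \<in> E_rel n I" "addrow_mat n (- x) i j \<in> E_rel n I"
  shows "addrow_mat n x i k \<in> E_rel n I"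
proof -
  have "addrow_mat n (- x) i j * (addrow_mat n (- 1) j k * addrow_mat n x i j * addrow_mat n (- (- 1)) j k) \<in> E_rel n I"
    using n el by (intro E_rel_conj E_rel_mult) auto
  also have "addrow_mat n (- x) i j * (addrow_mat n (- 1) j k * addrow_mat n x i j * addrow_mat n (- (- 1)) j k)
      = addrow_mat n x i k"
    by (rule mat_eq_by_rows[of _ n])
      (use n in \<open>auto simp: row_mult_mult[of _ n] row_mult_addrow_mat[of _ n] mult_carrier_mat[of _ n n]
         intro!: eq_vecI, (auto simp: algebra_simps)?\<close>)
  finally show ?thesis .
qed

lemma E_rel_move_row:
  fixes x :: "'a :: comm_ring_1"
  assumes n: "i < n" "j < n" "k < n" "i \<noteq> j" "j \<noteq> k" "i \<noteq> k"
    and el: "addrow_mat n x i j \<in> E_rel n I" "addrow_mat n (- x) i j \<in> E_rel n I"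
  shows "addrow_mat n x k j \<in> E_rel n I"
proof -
  have "addrow_mat n (- x) i j * (addrow_mat n 1 k i * addrow_mat n x i j * addrow_mat n (- 1) k i) \<in> E_rel n I"
    using n el by (intro E_rel_conj E_rel_mult) auto
  also have "addrow_mat n (- x) i j * (addrow_mat n 1 k i * addrow_mat n x i j * addrow_mat n (- 1) k i)
      = addrow_mat n x k j"
    by (rule mat_eq_by_rows[of _ n])
      (use n in \<open>auto simp: row_mult_mult[of _ n] row_mult_addrow_mat[of _ n] mult_carrier_mat[of _ n n]
         intro!: eq_vecI, (auto simp: algebra_simps)?\<close>)
  finally show ?thesis .
qed

lemma ideal_class_ringD:
  fixes I :: "'a :: comm_ring_1 set"
  assumes "ideal I class_ring"
  shows "x \<in> I \<Longrightarrow> y \<in> I \<Longrightarrow> x + y \<in> I" "x \<in> I \<Longrightarrow> y \<in> I \<Longrightarrow> x - y \<in> I"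
    "x \<in> I \<Longrightarrow> - x \<in> I" "x \<in> I \<Longrightarrow> r * x \<in> I" "x \<in> I \<Longrightarrow> x * r \<in> I"
proof -
  interpret ideal I "class_ring" by (rule assms)
  show l: "x \<in> I \<Longrightarrow> r * x \<in> I" and "x \<in> I \<Longrightarrow> x * r \<in> I" for r x
    using I_l_closed[of x r] I_r_closed[of x r] by (simp_all add: matrix_vs_simps)
  show a: "x \<in> I \<Longrightarrow> y \<in> I \<Longrightarrow> x + y \<in> I" for x y
    using additive_subgroup.a_closed[OF is_additive_subgroup, of x y] by (simp_all add: matrix_vs_simps)
  show m: "x \<in> I \<Longrightarrow> - x \<in> I" for x
  proof -
    assume "x \<in> I"
    then have "- 1 * x \<in> I" by (rule l)
    then show "- x \<in> I" by simp
  qed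
  show "x \<in> I \<Longrightarrow> y \<in> I \<Longrightarrow> x - y \<in> I" using a[of x "- y"] m by simp
qed

lemma addrow_mat_in_E_rel:
  fixes I :: "'a :: comm_ring_1 set"
  assumes "ideal I class_ring" "i < n" "j < n" "i \<noteq> j" "x \<in> I"
  shows "addrow_mat n x i j \<in> E_rel n I"
proof -
  have n: "0 < n" "1 < n" using assms by auto
  have 10: "\<And>x. x \<in> I \<Longrightarrow> addrow_mat n x 1 0 \<in> E_rel n I" unfolding E_rel_def by blast
  have neg: "\<And>x. x \<in> I \<Longrightarrow> - x \<in> I" using assms(1) by (rule ideal_class_ringD(3))
  \<comment> \<open>From position \<open>(1, 0)\<close> to row \<open>i\<close>, ending in column \<open>0\<close> or, if \<open>i = 0\<close>, in column \<open>1\<close>;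
    then along row \<open>i\<close> to column \<open>j\<close>.\<close>
  have 01: "\<And>x. x \<in> I \<Longrightarrow> addrow_mat n x 0 1 \<in> E_rel n I"
  proof -
    fix x assume "x \<in> I"
    then show "addrow_mat n x 0 1 \<in> E_rel n I"
      using 10 neg n by (intro E_rel_swap[of 1 n 0 x I]) auto
  qed
  have "\<And>x. x \<in> I \<Longrightarrow> addrow_mat n x i (if i = 0 then 1 else 0) \<in> E_rel n I"
    using E_rel_move_row[of 1 n 0 i _ I] 10 01 neg n assms(2) by (cases "i = 1") auto
  then show ?thesis
    using E_rel_move_column[of i n "if i = 0 then 1 else 0" j x I] neg n assms(2-)
    by (cases "j = (if i = 0 then 1 else 0)") auto
qed

section \<open>Rows in the same orbit of the relative group\<close>

definition E_rel_equiv :: "nat \<Rightarrow> 'a :: comm_ring_1 set \<Rightarrow> 'a vec \<Rightarrow> 'a vec \<Rightarrow> bool" where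
  "E_rel_equiv n I v w \<longleftrightarrow> (\<exists>A \<in> E_rel n I. row_mult v A = w)"

lemma E_rel_equiv_refl: "v \<in> carrier_vec n \<Longrightarrow> E_rel_equiv n I v v"
  unfolding E_rel_equiv_def using E_rel_one row_mult_one by blast

lemma E_rel_equiv_trans:
  assumes "2 \<le> n" "u \<in> carrier_vec n" "E_rel_equiv n I u v" "E_rel_equiv n I v w"
  shows "E_rel_equiv n I u w"
  using assms unfolding E_rel_equiv_def
  by (metis E_rel_mult E_rel_carrier row_mult_mult)

text \<open>
  Normality of the relative group lets an absolute elementary operation be applied to both rows:
  if \<open>v \<epsilon> = w\<close> then \<open>v g (g\<inverse> \<epsilon> g) = w g\<close>.
\<close>

lemma E_rel_equiv_row_mult_addrow_mat:
  assumes "v \<in> carrier_vec n" "i < n" "j < n" "i \<noteq> j" "E_rel_equiv n I v w"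
  shows "E_rel_equiv n I (row_mult v (addrow_mat n y i j)) (row_mult w (addrow_mat n y i j))"
proof -
  obtain A where A: "A \<in> E_rel n I" "row_mult v A = w"
    using assms(5) unfolding E_rel_equiv_def by blast
  have A': "A \<in> carrier_mat n n" using A(1) assms by (intro E_rel_carrier) auto
  let ?e = "\<lambda>y. addrow_mat n y i j"
  have "?e (- y) * A * ?e (- (- y)) \<in> E_rel n I" using A(1) assms(2-4) by (rule E_rel_conj)
  moreover have "row_mult (row_mult v (?e y)) (?e (- y) * A * ?e y) = row_mult w (?e y)"
  proof -
    have "row_mult (row_mult v (?e y)) (?e (- y) * A * ?e y) = row_mult v (?e y * (?e (- y) * A * ?e y))"
      using assms A' by (simp add: row_mult_mult[of _ n] mult_carrier_mat[of _ n n])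
    also have "?e y * (?e (- y) * A * ?e y) = ?e y * ?e (- y) * A * ?e y"
      using A' by (simp add: assoc_mult_mat[of _ n n _ n _ n] mult_carrier_mat[of _ n n])
    also have "\<dots> = A * ?e y" using A' assms by (simp add: addrow_mat_inv)
    finally show ?thesis using A(2) A' assms(1) by (simp add: row_mult_mult[of _ n])
  qed
  ultimately show ?thesis unfolding E_rel_equiv_def by auto
qed

lemma E_rel_equiv_add_multiples_of_last:
  assumes I: "ideal I class_ring" and m: "0 < m" and v: "v \<in> carrier_vec (Suc m)"
    and c: "\<And>i. i < m \<Longrightarrow> c i \<in> I"
  shows "E_rel_equiv (Suc m) I v (vec (Suc m) (\<lambda>j. if j = m then v $ m else v $ j + c j * v $ m))"
proof -
  let ?u = "\<lambda>k. vec (Suc m) (\<lambda>j. if j < k then v $ j + c j * v $ m else v $ j)"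
  have "E_rel_equiv (Suc m) I v (?u k)" if "k \<le> m" for k
    using that
  proof (induction k)
    case 0
    have "?u 0 = v" using v by (intro eq_vecI) auto
    then show ?case using E_rel_equiv_refl[OF v] by simp
  next
    case (Suc k)
    have "row_mult (?u k) (addrow_mat (Suc m) (c k) m k) = ?u (Suc k)"
      using Suc.prems by (auto simp: row_mult_addrow_mat[of _ "Suc m"] less_Suc_eq intro!: eq_vecI)
    moreover have "addrow_mat (Suc m) (c k) m k \<in> E_rel (Suc m) I"
      using Suc.prems c by (intro addrow_mat_in_E_rel I) auto
    ultimately have "E_rel_equiv (Suc m) I (?u k) (?u (Suc k))" unfolding E_rel_equiv_def by blast
    with Suc v m show ?case by (intro E_rel_equiv_trans[of "Suc m" v I "?u k" "?u (Suc k)"]) auto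
  qed
  from this[of m] have "E_rel_equiv (Suc m) I v (?u m)" by simp
  also have "?u m = vec (Suc m) (\<lambda>j. if j = m then v $ m else v $ j + c j * v $ m)"
    by (intro eq_vecI) auto
  finally show ?thesis .
qed

lemma E_rel_equiv_add_combination_to_last:
  assumes I: "ideal I class_ring" and m: "0 < m" and v: "v \<in> carrier_vec (Suc m)"
    and c: "\<And>i. i < m \<Longrightarrow> c i \<in> I"
  shows "E_rel_equiv (Suc m) I v
    (vec (Suc m) (\<lambda>j. if j = m then v $ m + (\<Sum>i<m. c i * v $ i) else v $ j))"
proof -
  let ?u = "\<lambda>k. vec (Suc m) (\<lambda>j. if j = m then v $ m + (\<Sum>i<k. c i * v $ i) else v $ j)"
  have "E_rel_equiv (Suc m) I v (?u k)" if "k \<le> m" for k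
    using that
  proof (induction k)
    case 0
    have "?u 0 = v" using v by (intro eq_vecI) auto
    then show ?case using E_rel_equiv_refl[OF v] by simp
  next
    case (Suc k)
    have "row_mult (?u k) (addrow_mat (Suc m) (c k) k m) = ?u (Suc k)"
      using Suc.prems by (auto simp: row_mult_addrow_mat[of _ "Suc m"] algebra_simps intro!: eq_vecI)
    moreover have "addrow_mat (Suc m) (c k) k m \<in> E_rel (Suc m) I"
      using Suc.prems c by (intro addrow_mat_in_E_rel I) auto
    ultimately have "E_rel_equiv (Suc m) I (?u k) (?u (Suc k))" unfolding E_rel_equiv_def by blast
    with Suc v m show ?case by (intro E_rel_equiv_trans[of "Suc m" v I "?u k" "?u (Suc k)"]) auto
  qed
  from this[of m] show ?thesis by simp
qed

section \<open>The stable range of the ring\<close>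

text \<open>
  Unimodularity of the first \<open>k\<close> entries of a sequence; sequences are easier to cut, join and
  modify than vectors.
\<close>

definition unimodular :: "nat \<Rightarrow> (nat \<Rightarrow> 'a :: comm_ring_1) \<Rightarrow> bool" where
  "unimodular k f \<longleftrightarrow> (\<exists>g. (\<Sum>i<k. f i * g i) = 1)"

lemma vec_in_Um_iff: "vec k f \<in> Um k \<longleftrightarrow> unimodular k f"
proof
  assume "vec k f \<in> Um k"
  then obtain w where "w \<in> carrier_vec k" "vec k f \<bullet> w = 1" unfolding Um_def by blast
  then have "(\<Sum>i<k. f i * w $ i) = 1" by (simp add: scalar_prod_def lessThan_atLeast0)
  then show "unimodular k f" unfolding unimodular_def by blast
next
  assume "unimodular k f"
  then obtain g where "(\<Sum>i<k. f i * g i) = 1" unfolding unimodular_def by blast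
  then have "vec k f \<bullet> vec k g = 1" by (simp add: scalar_prod_def lessThan_atLeast0)
  then show "vec k f \<in> Um k" unfolding Um_def by (auto intro!: bexI[of _ "vec k g"])
qed

lemma stable_range_cond_UNIV_iff:
  "stable_range_cond k (UNIV :: 'a :: comm_ring_1 set) \<longleftrightarrow>
    (\<forall>f :: nat \<Rightarrow> 'a. unimodular (Suc k) f \<longrightarrow> (\<exists>c. unimodular k (\<lambda>i. f i + c i * f k)))"
  (is "?l \<longleftrightarrow> ?r")
proof
  assume l: ?l
  show ?r
  proof (intro allI impI)
    fix f :: "nat \<Rightarrow> 'a" assume "unimodular (Suc k) f"
    then have "vec (Suc k) f \<in> Um_rel (k + 1) UNIV" by (simp add: Um_rel_def vec_in_Um_iff)
    then obtain c where "vec k (\<lambda>i. vec (Suc k) f $ i + c $ i * vec (Suc k) f $ k) \<in> Um_rel k UNIV"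
      using l unfolding stable_range_cond_def by blast
    also have "vec k (\<lambda>i. vec (Suc k) f $ i + c $ i * vec (Suc k) f $ k) = vec k (\<lambda>i. f i + c $ i * f k)"
      by (intro eq_vecI) auto
    finally show "\<exists>c. unimodular k (\<lambda>i. f i + c i * f k)"
      by (auto simp: Um_rel_def vec_in_Um_iff)
  qed
next
  assume r: ?r
  show ?l
    unfolding stable_range_cond_def
  proof
    fix a :: "'a vec" assume a: "a \<in> Um_rel (k + 1) UNIV"
    then have "vec (Suc k) (($) a) = a" by (intro eq_vecI) (auto simp: Um_rel_def Um_def)
    with a have "unimodular (Suc k) (($) a)" by (simp add: Um_rel_def flip: vec_in_Um_iff)
    then obtain c where c: "unimodular k (\<lambda>i. a $ i + c i * a $ k)" using r by blast
    have "vec k (\<lambda>i. a $ i + vec k c $ i * a $ k) = vec k (\<lambda>i. a $ i + c i * a $ k)"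
      by (intro eq_vecI) auto
    with c show "\<exists>c\<in>carrier_vec k. (\<forall>i<k. c $ i \<in> UNIV) \<and> vec k (\<lambda>i. a $ i + c $ i * a $ k) \<in> Um_rel k UNIV"
      by (intro bexI[of _ "vec k c"]) (simp_all add: Um_rel_def vec_in_Um_iff)
  qed
qed

text \<open>
  In a unimodular row of length \<open>k + 2\<close> the last two entries can be contracted to the combination
  \<open>s\<close> of them that occurs in the unimodularity relation. The condition for \<open>k\<close> then adds multiples of
  \<open>s\<close> to the first \<open>k\<close> entries; modulo the entry with index \<open>k\<close>, which is kept, these are multiples of
  the last entry.
\<close>

lemma stable_range_cond_Suc:
  assumes "stable_range_cond k (UNIV :: 'a :: comm_ring_1 set)"
  shows "stable_range_cond (Suc k) (UNIV :: 'a set)"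
  unfolding stable_range_cond_UNIV_iff
proof (intro allI impI)
  fix f :: "nat \<Rightarrow> 'a" assume "unimodular (Suc (Suc k)) f"
  then obtain g where g: "(\<Sum>i<k. f i * g i) + (f k * g k + f (Suc k) * g (Suc k)) = 1"
    unfolding unimodular_def by (auto simp: add.assoc)
  let ?s = "f k * g k + f (Suc k) * g (Suc k)"
  have "unimodular (Suc k) (f(k := ?s))"
    unfolding unimodular_def using g by (intro exI[of _ "g(k := 1)"]) simp
  then obtain c where "unimodular k (\<lambda>i. (f(k := ?s)) i + c i * (f(k := ?s)) k)"
    using assms unfolding stable_range_cond_UNIV_iff by blast
  then obtain h where "(\<Sum>i<k. (f i + c i * ?s) * h i) = 1"
    unfolding unimodular_def by auto
  also have "(\<Sum>i<k. (f i + c i * ?s) * h i)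
      = (\<Sum>i<k. (f i + c i * g (Suc k) * f (Suc k)) * h i) + f k * (g k * (\<Sum>i<k. c i * h i))"
    by (simp add: algebra_simps sum.distrib sum_distrib_left)
  finally have "unimodular (Suc k) (\<lambda>i. f i + (if i = k then 0 else c i * g (Suc k)) * f (Suc k))"
    unfolding unimodular_def
    by (intro exI[of _ "h(k := g k * (\<Sum>i<k. c i * h i))"]) simp
  then show "\<exists>c. unimodular (Suc k) (\<lambda>i. f i + c i * f (Suc k))"
    by (intro exI[of _ "\<lambda>i. if i = k then 0 else c i * g (Suc k)"])
qed

lemma stable_range_cond_mono:
  assumes "j \<le> k" "stable_range_cond j (UNIV :: 'a :: comm_ring_1 set)"
  shows "stable_range_cond k (UNIV :: 'a set)"
  using assms by (induction k rule: dec_induct) (auto intro: stable_range_cond_Suc)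

lemma stable_range_cond_if_stable_dim:
  assumes "stable_dim (UNIV :: 'a :: comm_ring_1 set) = enat d" and "d < k"
  shows "stable_range_cond k (UNIV :: 'a set)"
proof -
  let ?S = "{n. 1 \<le> n \<and> stable_range_cond n (UNIV :: 'a set)}"
  have "?S \<noteq> {}"
  proof
    assume S: "?S = {}"
    have "stable_range (UNIV :: 'a set) = \<infinity>"
      unfolding stable_range_def S by (simp add: top_enat_def)
    with assms(1) show False by (simp add: stable_dim_def)
  qed
  then have "stable_range (UNIV :: 'a set) \<in> enat ` ?S"
    unfolding stable_range_def Inf_enat_def using LeastI_ex[of "\<lambda>x. x \<in> enat ` ?S"] by auto
  then obtain j where j: "stable_range_cond j (UNIV :: 'a set)" "stable_range (UNIV :: 'a set) = enat j"
    by blast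
  have "j - 1 = d" using assms(1) j(2) by (simp add: stable_dim_def one_enat_def)
  then show ?thesis using stable_range_cond_mono[OF _ j(1), of k] assms(2) by linarith
qed

lemma sum_lessThan_add:
  fixes m k :: nat
  shows "(\<Sum>i<m + k. f i) = (\<Sum>i<m. f i) + (\<Sum>i<k. f (m + i) :: 'a :: comm_monoid_add)"
  by (induction k) (simp_all add: add.assoc)

section \<open>Making two rows agree except in the last entry\<close>

text \<open>
  If \<open>A + a\<^sub>m p\<^sub>m = 1\<close> and \<open>B + b\<^sub>m q\<^sub>m = 1\<close>, where \<open>A\<close> and \<open>B\<close> are combinations of the other entries of
  the two rows, then \<open>1 = A + a\<^sub>m p\<^sub>m (B + b\<^sub>m q\<^sub>m)\<close>, which is a unimodularity relation for
  \<open>(a\<^sub>0, \<dots>, a\<^bsub>m-1\<^esub>, b\<^sub>0, \<dots>, b\<^bsub>m-1\<^esub>, a\<^sub>m b\<^sub>m)\<close>.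
\<close>

lemma unimodular_after_adding_product:
  fixes a b :: "nat \<Rightarrow> 'a :: comm_ring_1"
  assumes sr: "stable_range_cond (m + m) (UNIV :: 'a set)"
    and a: "unimodular (Suc m) a" and b: "unimodular (Suc m) b"
  obtains c r s where
    "(\<Sum>i<m. (a i + c i * (a m * b m)) * r i) + (\<Sum>i<m. (b i + c (m + i) * (a m * b m)) * s i) = 1"
proof -
  obtain p where p: "(\<Sum>i<m. a i * p i) + a m * p m = 1"
    using a unfolding unimodular_def by auto
  obtain q where q: "(\<Sum>i<m. b i * q i) + b m * q m = 1"
    using b unfolding unimodular_def by auto
  define f where "f = (\<lambda>i. if i < m then a i else if i < m + m then b (i - m) else a m * b m)"
  define g where "g = (\<lambda>i. if i < m then p i else if i < m + m then a m * p m * q (i - m) else p m * q m)"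
  have "(\<Sum>i<Suc (m + m). f i * g i)
      = (\<Sum>i<m. a i * p i) + (\<Sum>i<m. b i * (a m * p m * q i)) + a m * b m * (p m * q m)"
    by (simp add: sum_lessThan_add f_def g_def)
  also have "\<dots> = (\<Sum>i<m. a i * p i) + a m * p m * ((\<Sum>i<m. b i * q i) + b m * q m)"
    by (simp add: algebra_simps sum_distrib_left)
  also have "\<dots> = 1" using p q by simp
  finally have "unimodular (Suc (m + m)) f" unfolding unimodular_def by blast
  then obtain c where "unimodular (m + m) (\<lambda>i. f i + c i * f (m + m))"
    using sr unfolding stable_range_cond_UNIV_iff by blast
  then obtain h where "(\<Sum>i<m + m. (f i + c i * f (m + m)) * h i) = 1"
    unfolding unimodular_def by blast
  then show thesis
    by (intro that[of c h "\<lambda>i. h (m + i)"]) (simp add: sum_lessThan_add f_def)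
qed

text \<open>
  With \<open>\<alpha> = v\<^sub>m + v\<^sub>0\<close> and \<open>\<beta> = w\<^sub>m\<close>, the entries \<open>c\<^sub>j = v\<^sub>j \<beta> + w\<^sub>j \<alpha>\<close> are reached from both rows by adding
  \<open>I\<close>-multiples of the last entry, once \<open>\<alpha>\<close> is the last entry of the first row. Conjugation by
  \<open>E\<^bsub>0m\<^esub>(1)\<close> puts it there; undoing the conjugation is what subtracts \<open>c\<^sub>0\<close> from \<open>\<alpha>\<close>.
\<close>

lemma E_rel_equiv_common_row:
  fixes I :: "'a :: comm_ring_1 set"
  assumes I: "ideal I class_ring" and m: "0 < m"
    and v: "v \<in> carrier_vec (Suc m)" and w: "w \<in> carrier_vec (Suc m)"
    and diff: "\<And>j. j < m \<Longrightarrow> w $ j - v $ j \<in> I"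
    and sum1: "v $ m + v $ 0 + w $ m = 1"
  obtains c where
    "E_rel_equiv (Suc m) I v (vec (Suc m) (\<lambda>j. if j = m then v $ m + v $ 0 - c 0 else c j))"
    "E_rel_equiv (Suc m) I w (vec (Suc m) (\<lambda>j. if j = m then w $ m else c j))"
proof
  define \<alpha> where "\<alpha> = v $ m + v $ 0"
  have wm: "w $ m = 1 - \<alpha>" using sum1 by (simp add: \<alpha>_def algebra_simps)
  define c where "c = (\<lambda>j. v $ j + (w $ j - v $ j) * \<alpha>)"
  let ?e = "\<lambda>y. addrow_mat (Suc m) y 0 m"
  let ?v = "row_mult v (?e 1)"
  let ?u = "vec (Suc m) (\<lambda>j. if j = m then ?v $ m else ?v $ j + (w $ j - v $ j) * ?v $ m)"
  have v': "?v = vec (Suc m) (\<lambda>j. if j = m then \<alpha> else v $ j)"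
    using v m by (auto simp: row_mult_addrow_mat[of _ "Suc m"] \<alpha>_def)
  have "E_rel_equiv (Suc m) I ?v ?u"
    by (rule E_rel_equiv_add_multiples_of_last[OF I m]) (use diff in \<open>auto simp: v'\<close>)
  then have "E_rel_equiv (Suc m) I (row_mult ?v (?e (- 1))) (row_mult ?u (?e (- 1)))"
    using m by (intro E_rel_equiv_row_mult_addrow_mat) (auto simp: v')
  also have "row_mult ?v (?e (- 1)) = v"
    using v m by (auto simp: v' row_mult_addrow_mat[of _ "Suc m"] \<alpha>_def intro!: eq_vecI)
  also have "row_mult ?u (?e (- 1))
      = vec (Suc m) (\<lambda>j. if j = m then v $ m + v $ 0 - c 0 else c j)"
    using m by (auto simp: v' row_mult_addrow_mat[of _ "Suc m"] c_def \<alpha>_def intro!: eq_vecI)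
  finally show "E_rel_equiv (Suc m) I v (vec (Suc m) (\<lambda>j. if j = m then v $ m + v $ 0 - c 0 else c j))" .
  have "- (w $ j - v $ j) \<in> I" if "j < m" for j
    by (rule ideal_class_ringD(3)[OF I diff[OF that]])
  then have "E_rel_equiv (Suc m) I w
      (vec (Suc m) (\<lambda>j. if j = m then w $ m else w $ j + (v $ j - w $ j) * w $ m))"
    using m by (intro E_rel_equiv_add_multiples_of_last I w) auto
  also have "vec (Suc m) (\<lambda>j. if j = m then w $ m else w $ j + (v $ j - w $ j) * w $ m)
      = vec (Suc m) (\<lambda>j. if j = m then w $ m else c j)"
    by (auto simp: wm c_def algebra_simps intro!: eq_vecI)
  finally show "E_rel_equiv (Suc m) I w (vec (Suc m) (\<lambda>j. if j = m then w $ m else c j))" .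
qed

lemma unit_mod_if_diff_one:
  assumes "ideal J class_ring" "x - 1 \<in> J"
  shows "unit_mod x J"
proof -
  interpret J: ideal J "class_ring" by (rule assms(1))
  interpret Q: ring "class_ring Quot J" by (rule J.quotient_is_ring)
  have "x \<in> J +>\<^bsub>class_ring\<^esub> 1"
    using assms(2) by (auto simp: a_r_coset_def' matrix_vs_simps intro!: bexI[of _ "x - 1"])
  then have "J +>\<^bsub>class_ring\<^esub> x = \<one>\<^bsub>class_ring Quot J\<^esub>"
    using J.a_repr_independence'[of x 1] by (simp add: FactRing_def matrix_vs_simps)
  then show ?thesis unfolding unit_mod_def by simp
qed

theorem lemma7p3:
  fixes I :: "'a :: comm_ring_1 set" and v w :: "'a vec" and n d :: nat
  assumes "stable_dim (UNIV :: 'a set) = enat d"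
    and "int d \<le> 2 * int n - 3"
    and "ideal I class_ring"
    and "v \<in> Um_rel n I" and "w \<in> Um_rel n I"
  shows "\<exists>\<epsilon>\<^sub>1 \<in> E_rel n I. \<exists>\<epsilon>\<^sub>2 \<in> E_rel n I. \<exists>as a b. length as = n - 1 \<and>
           row_mult v \<epsilon>\<^sub>1 = vec_of_list (as @ [a]) \<and>
           row_mult w \<epsilon>\<^sub>2 = vec_of_list (as @ [b]) \<and>
           unit_mod (a + b) (Idl\<^bsub>class_ring\<^esub> (set as))"
proof -
  note I = assms(3) and I_closed = ideal_class_ringD[OF assms(3)]
  define m where "m = n - 1"
  have n: "n = Suc m" and m: "0 < m" and d: "d < m + m" using assms(2) by (auto simp: m_def)
  have trans: "\<And>x y z. x \<in> carrier_vec n \<Longrightarrow> E_rel_equiv n I x y \<Longrightarrow> E_rel_equiv n I y z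
      \<Longrightarrow> E_rel_equiv n I x z"
    using m n E_rel_equiv_trans by (metis Suc_le_mono Suc_leI numeral_2_eq_2)
  have v: "v \<in> carrier_vec (Suc m)" and w: "w \<in> carrier_vec (Suc m)"
    using assms(4,5) by (auto simp: Um_rel_def Um_def n)
  have mod_I: "v $ j - unit_vec n 0 $ j \<in> I" "w $ j - unit_vec n 0 $ j \<in> I" if "j < n" for j
    using assms(4,5) that by (auto simp: Um_rel_def)
  have last_I: "v $ m \<in> I" "w $ m \<in> I" using mod_I[of m] m by (auto simp: n)
  have "vec (Suc m) (($) v) = v" "vec (Suc m) (($) w) = w" using v w by (auto intro!: eq_vecI)
  then have "unimodular (Suc m) (($) v)" "unimodular (Suc m) (($) w)"
    using assms(4,5) by (simp_all add: Um_rel_def n flip: vec_in_Um_iff)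
  then obtain c r s where one: "(\<Sum>i<m. (v $ i + c i * (v $ m * w $ m)) * r i)
      + (\<Sum>i<m. (w $ i + c (m + i) * (v $ m * w $ m)) * s i) = 1"
    using unimodular_after_adding_product stable_range_cond_if_stable_dim[OF assms(1) d] by blast
  define v1 where "v1 = vec n (\<lambda>j. if j = m then v $ m else v $ j + c j * w $ m * v $ m)"
  define w1 where "w1 = vec n (\<lambda>j. if j = m then w $ m else w $ j + c (m + j) * v $ m * w $ m)"
  have v1: "v1 \<in> carrier_vec n" and w1: "w1 \<in> carrier_vec n" by (auto simp: v1_def w1_def)
  have "E_rel_equiv n I v v1" "E_rel_equiv n I w w1"
    unfolding v1_def w1_def n using I m v w last_I
    by (simp_all add: E_rel_equiv_add_multiples_of_last I_closed(4))
  have mod_I1: "v1 $ j - unit_vec n 0 $ j \<in> I" "w1 $ j - unit_vec n 0 $ j \<in> I" if "j < m" for j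
  proof -
    have "v $ j - unit_vec n 0 $ j + c j * w $ m * v $ m \<in> I"
      "w $ j - unit_vec n 0 $ j + c (m + j) * v $ m * w $ m \<in> I"
      using that mod_I[of j] last_I by (intro I_closed(1) I_closed(4); simp add: n)+
    then show "v1 $ j - unit_vec n 0 $ j \<in> I" "w1 $ j - unit_vec n 0 $ j \<in> I"
      using that by (simp_all add: v1_def w1_def n algebra_simps)
  qed
  \<comment> \<open>The first entry \<open>v1 $ 0\<close> is counted here because it is \<open>1\<close> modulo \<open>I\<close>; this puts \<open>t\<close> into \<open>I\<close>.\<close>
  define t where "t = 1 - v1 $ m - v1 $ 0 - w1 $ m"
  have t_alt: "t = - (v1 $ 0 - unit_vec n 0 $ 0) - v $ m - w $ m"
    using m by (simp add: t_def v1_def w1_def n)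
  have t: "t \<in> I"
    unfolding t_alt by (rule I_closed(2)[OF I_closed(2)[OF I_closed(3)[OF mod_I1(1)[OF m]]]] last_I)+
  have one1: "(\<Sum>i<m. r i * v1 $ i) + (\<Sum>i<m. s i * w1 $ i) = 1"
    using one by (simp add: v1_def w1_def n algebra_simps)
  define v2 where "v2 = vec n (\<lambda>j. if j = m then v1 $ m + (\<Sum>i<m. t * r i * v1 $ i) else v1 $ j)"
  define w2 where "w2 = vec n (\<lambda>j. if j = m then w1 $ m + (\<Sum>i<m. t * s i * w1 $ i) else w1 $ j)"
  have v2: "v2 \<in> carrier_vec (Suc m)" and w2: "w2 \<in> carrier_vec (Suc m)"
    by (auto simp: v2_def w2_def n)
  have "E_rel_equiv n I v1 v2" "E_rel_equiv n I w1 w2"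
    unfolding v2_def w2_def n using I m v1[unfolded n] w1[unfolded n] t
    by (simp_all add: E_rel_equiv_add_combination_to_last I_closed(5))
  have "(\<Sum>i<m. t * r i * v1 $ i) + (\<Sum>i<m. t * s i * w1 $ i) = t"
    using arg_cong[OF one1, of "\<lambda>x. t * x"] by (simp add: sum_distrib_left algebra_simps)
  then have sum2: "v2 $ m + v2 $ 0 + w2 $ m = 1"
    using m by (simp add: v2_def w2_def n t_def algebra_simps)
  have diff2: "w2 $ j - v2 $ j \<in> I" if "j < m" for j
  proof -
    have "(w1 $ j - unit_vec n 0 $ j) - (v1 $ j - unit_vec n 0 $ j) \<in> I"
      by (rule I_closed(2)[OF mod_I1(2)[OF that] mod_I1(1)[OF that]])
    then show ?thesis using that by (simp add: v2_def w2_def n)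
  qed
  obtain c' where c':
    "E_rel_equiv n I v2 (vec n (\<lambda>j. if j = m then v2 $ m + v2 $ 0 - c' 0 else c' j))"
    "E_rel_equiv n I w2 (vec n (\<lambda>j. if j = m then w2 $ m else c' j))"
    using E_rel_equiv_common_row[OF I m v2 w2 diff2 sum2] unfolding n by blast
  define as where "as = map c' [0..<m]"
  have as: "vec n (\<lambda>j. if j = m then x else c' j) = vec_of_list (as @ [x])" for x
    by (intro eq_vecI) (auto simp: n as_def vec_of_list_index nth_append less_Suc_eq)
  let ?a = "v2 $ m + v2 $ 0 - c' 0" and ?b = "w2 $ m"
  have "E_rel_equiv n I v (vec_of_list (as @ [?a]))" "E_rel_equiv n I w (vec_of_list (as @ [?b]))"
    using trans[OF _ trans[OF _ \<open>E_rel_equiv n I v v1\<close> \<open>E_rel_equiv n I v1 v2\<close>] c'(1)]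
      trans[OF _ trans[OF _ \<open>E_rel_equiv n I w w1\<close> \<open>E_rel_equiv n I w1 w2\<close>] c'(2)]
    using v w unfolding as by (simp_all add: n)
  moreover have "unit_mod (?a + ?b) (Idl\<^bsub>class_ring\<^esub> (set as))"
  proof (rule unit_mod_if_diff_one)
    show J: "ideal (Idl\<^bsub>class_ring\<^esub> (set as)) class_ring"
      by (intro ring.genideal_ideal[OF class_ring.ring_axioms]) (simp add: matrix_vs_simps)
    have "set as \<subseteq> Idl\<^bsub>class_ring\<^esub> (set as)"
      by (intro ring.genideal_self[OF class_ring.ring_axioms]) (simp add: matrix_vs_simps)
    then have "c' 0 \<in> Idl\<^bsub>class_ring\<^esub> (set as)" using m by (auto simp: as_def)
    then have "- c' 0 \<in> Idl\<^bsub>class_ring\<^esub> (set as)" by (rule ideal_class_ringD(3)[OF J])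
    moreover have "?a + ?b - 1 = - c' 0" using sum2 by (simp add: algebra_simps)
    ultimately show "?a + ?b - 1 \<in> Idl\<^bsub>class_ring\<^esub> (set as)" by metis
  qed
  moreover have "length as = n - 1" by (simp add: as_def m_def)
  ultimately show ?thesis unfolding E_rel_equiv_def by blast
qed

end
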